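(* The class $B_{\frac n2}(X\times X)$ can contain a Cauchy sequence whose limit is not an $\frac n2$-bounded bigroup homomorphism. That is, there exist a topological ring $R$, a topological module $X$ over $R$, a sequence $(\sigma_k)_{k\in\mathbb N}$ of $\frac n2$-bounded bigroup homomorphisms $X\times X\to X$ that is Cauchy with respect to $\sigma$-uniform convergence on some zero neighborhood, and a bigroup homomorphism $\sigma:X\times X\to X$ such that $\sigma_k\to\sigma$ $\sigma$-uniformly on some zero neighborhood, but $\sigma$ is not $\frac n2$-bounded.
   Context: A topological module $X$ over a topological ring $R$ is an $R$-module with a topology making $X$ a topological additive group and making the multiplication $R\times X\to X$ (jointly) continuous. A zero neighborhood is a neighborhood of $0$. A set $B\subseteq X$ is bounded if for each zero neighborhood $W\subseteq X$ there is a zero neighborhood $V\subseteq R$ such that $VB\subseteq W$, where $VB=\{vb: v\in V, b\in B\}$. A bigroup homomorphism $\sigma:X\times X\to X$ is a map that is a homomorphism of additive groups in each variable separately. For $A,B\subseteq X$, $\sigma(A,B)=\{\sigma(a,b):a\in A,b\in B\}$. $\sigma$ is $\frac n2$-bounded (the symbol $\frac n2$ is part of the name) if there exists a zero neighborhood $U\subseteq X$ such that for each bounded set $B\subseteq X$, $\sigma(U,B)$ is bounded in $X$; $B_{\frac n2}(X\times X)$ is the set of all such $\sigma$. A sequence $(\sigma_k)$ of bigroup homomorphisms converges to $\sigma$ $\sigma$-uniformly on some zero neighborhood (here "$\sigma$-uniformly" is just a name) if there exists a zero neighborhood $U\subseteq X$ such that for each zero neighborhood $W\subseteq X$ and each bounded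 set $B\subseteq X$ there is $k_0$ with $(\sigma_k-\sigma)(U,B)\subseteq W$ for all $k\ge k_0$. It is Cauchy in this sense if there exists a zero neighborhood $U\subseteq X$ such that for each zero neighborhood $W\subseteq X$ and each bounded set $B\subseteq X$ there is $k_0$ with $(\sigma_k-\sigma_m)(U,B)\subseteq W$ for all $k,m\ge k_0$. *)

theory Defs
  imports "HOL-Algebra.Module" "HOL-Analysis.Product_Topology"
begin

text \<open>
  Rings and modules are the carrier-based structures of \<open>HOL-Algebra\<close>; their topologies are
  abstract topologies whose underlying set is the carrier. No separation axiom is assumed.
\<close>

locale topological_additive_group = abelian_group G for G (structure) +
  fixes T :: "'a topology"
  assumes topspace_eq: "topspace T = carrier G"
    and continuous_add: "continuous_map (prod_topology T T) T (\<lambda>(x, y). x \<oplus> y)"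
    and continuous_minus: "continuous_map T T (\<lambda>x. \<ominus> x)"

locale topological_ring = ring R + topological_additive_group R T for R (structure) and T +
  assumes continuous_mult: "continuous_map (prod_topology T T) T (\<lambda>(x, y). x \<otimes> y)"

text \<open>
  The library locale \<^locale>\<open>Module.module\<close> requires a commutative ring of scalars; the following is the same
  notion over an arbitrary (unital, associative) ring.
\<close>

locale left_module = R?: ring R + M?: abelian_group M
  for R (structure) and M :: "('a, 'b, 'm) module_scheme" (structure) +
  assumes smult_closed:
      "\<lbrakk>a \<in> carrier R; x \<in> carrier M\<rbrakk> \<Longrightarrow> a \<odot>\<^bsub>M\<^esub> x \<in> carrier M"
    and smult_l_distr:
      "\<lbrakk>a \<in> carrier R; b \<in> carrier R; x \<in> carrier M\<rbrakk> \<Longrightarrow>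
        (a \<oplus>\<^bsub>R\<^esub> b) \<odot>\<^bsub>M\<^esub> x = a \<odot>\<^bsub>M\<^esub> x \<oplus>\<^bsub>M\<^esub> b \<odot>\<^bsub>M\<^esub> x"
    and smult_r_distr:
      "\<lbrakk>a \<in> carrier R; x \<in> carrier M; y \<in> carrier M\<rbrakk> \<Longrightarrow>
        a \<odot>\<^bsub>M\<^esub> (x \<oplus>\<^bsub>M\<^esub> y) = a \<odot>\<^bsub>M\<^esub> x \<oplus>\<^bsub>M\<^esub> a \<odot>\<^bsub>M\<^esub> y"
    and smult_assoc:
      "\<lbrakk>a \<in> carrier R; b \<in> carrier R; x \<in> carrier M\<rbrakk> \<Longrightarrow>
        (a \<otimes>\<^bsub>R\<^esub> b) \<odot>\<^bsub>M\<^esub> x = a \<odot>\<^bsub>M\<^esub> (b \<odot>\<^bsub>M\<^esub> x)"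
    and smult_one:
      "x \<in> carrier M \<Longrightarrow> \<one>\<^bsub>R\<^esub> \<odot>\<^bsub>M\<^esub> x = x"

lemma left_module_iff_module:
  assumes "cring R"
  shows "left_module R M \<longleftrightarrow> Module.module R M"
proof
  assume "left_module R M"
  then interpret left_module R M .
  show "Module.module R M"
    by (intro Module.moduleI assms M.abelian_group_axioms smult_closed smult_l_distr smult_r_distr
        smult_assoc smult_one)
next
  assume "Module.module R M"
  then interpret Module.module R M .
  show "left_module R M"
    by (intro left_module.intro left_module_axioms.intro R.ring_axioms M.abelian_group_axioms
        smult_closed smult_l_distr smult_r_distr smult_assoc1 smult_one)
qed

locale topological_module =
  R?: topological_ring R TR + X?: topological_additive_group X TX + left_module R X
  for R (structure) and TR and X (structure) and TX +
  assumes continuous_smult: "continuous_map (prod_topology TR TX) TX (\<lambda>(a, x). a \<odot>\<^bsub>X\<^esub> x)"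

text \<open>Neighborhoods need not be open.\<close>

definition zero_nbhd :: "('a, 'm) ring_scheme \<Rightarrow> 'a topology \<Rightarrow> 'a set \<Rightarrow> bool" where
  "zero_nbhd G T U \<longleftrightarrow> U \<subseteq> topspace T \<and> \<zero>\<^bsub>G\<^esub> \<in> T interior_of U"

definition module_bounded ::
  "('a, 'r) ring_scheme \<Rightarrow> 'a topology \<Rightarrow> ('a, 'b, 'm) module_scheme \<Rightarrow> 'b topology \<Rightarrow> 'b set \<Rightarrow> bool"
  where
  "module_bounded R TR X TX B \<longleftrightarrow>
     B \<subseteq> carrier X \<and>
     (\<forall>W. zero_nbhd X TX W \<longrightarrow>
       (\<exists>V. zero_nbhd R TR V \<and> {v \<odot>\<^bsub>X\<^esub> b | v b. v \<in> V \<and> b \<in> B} \<subseteq> W))"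

text \<open>
  Maps of two variables are curried. Only their values on the carrier matter.
\<close>

definition bigroup_hom :: "('b, 'm) ring_scheme \<Rightarrow> ('b \<Rightarrow> 'b \<Rightarrow> 'b) \<Rightarrow> bool" where
  "bigroup_hom X \<sigma> \<longleftrightarrow>
     (\<forall>x \<in> carrier X. (\<lambda>y. \<sigma> x y) \<in> hom (add_monoid X) (add_monoid X)) \<and>
     (\<forall>y \<in> carrier X. (\<lambda>x. \<sigma> x y) \<in> hom (add_monoid X) (add_monoid X))"

definition bi_image :: "('b \<Rightarrow> 'b \<Rightarrow> 'b) \<Rightarrow> 'b set \<Rightarrow> 'b set \<Rightarrow> 'b set" where
  "bi_image \<sigma> A B = {\<sigma> a b | a b. a \<in> A \<and> b \<in> B}"

definition bi_diff ::
  "('b, 'm) ring_scheme \<Rightarrow> ('b \<Rightarrow> 'b \<Rightarrow> 'b) \<Rightarrow> ('b \<Rightarrow> 'b \<Rightarrow> 'b) \<Rightarrow> 'b \<Rightarrow> 'b \<Rightarrow> 'b" where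
  "bi_diff X \<sigma> \<tau> = (\<lambda>x y. \<sigma> x y \<ominus>\<^bsub>X\<^esub> \<tau> x y)"

definition half_n_bounded ::
  "('a, 'r) ring_scheme \<Rightarrow> 'a topology \<Rightarrow> ('a, 'b, 'm) module_scheme \<Rightarrow> 'b topology \<Rightarrow>
    ('b \<Rightarrow> 'b \<Rightarrow> 'b) \<Rightarrow> bool" where
  "half_n_bounded R TR X TX \<sigma> \<longleftrightarrow>
     (\<exists>U. zero_nbhd X TX U \<and>
       (\<forall>B. module_bounded R TR X TX B \<longrightarrow> module_bounded R TR X TX (bi_image \<sigma> U B)))"

definition B_half_n ::
  "('a, 'r) ring_scheme \<Rightarrow> 'a topology \<Rightarrow> ('a, 'b, 'm) module_scheme \<Rightarrow> 'b topology \<Rightarrow>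
    ('b \<Rightarrow> 'b \<Rightarrow> 'b) set" where
  "B_half_n R TR X TX = {\<sigma>. bigroup_hom X \<sigma> \<and> half_n_bounded R TR X TX \<sigma>}"

text \<open>
  In the next two definitions the zero neighborhood \<open>U\<close> is chosen before \<open>W\<close> and \<open>B\<close>, whereas the
  index \<open>k0\<close> may depend on both.
\<close>

definition sigma_converges ::
  "('a, 'r) ring_scheme \<Rightarrow> 'a topology \<Rightarrow> ('a, 'b, 'm) module_scheme \<Rightarrow> 'b topology \<Rightarrow>
    (nat \<Rightarrow> 'b \<Rightarrow> 'b \<Rightarrow> 'b) \<Rightarrow> ('b \<Rightarrow> 'b \<Rightarrow> 'b) \<Rightarrow> bool" where
  "sigma_converges R TR X TX s \<sigma> \<longleftrightarrow>
     (\<exists>U. zero_nbhd X TX U \<and>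
       (\<forall>W B. zero_nbhd X TX W \<longrightarrow> module_bounded R TR X TX B \<longrightarrow>
         (\<exists>k0. \<forall>k\<ge>k0. bi_image (bi_diff X (s k) \<sigma>) U B \<subseteq> W)))"

definition sigma_Cauchy ::
  "('a, 'r) ring_scheme \<Rightarrow> 'a topology \<Rightarrow> ('a, 'b, 'm) module_scheme \<Rightarrow> 'b topology \<Rightarrow>
    (nat \<Rightarrow> 'b \<Rightarrow> 'b \<Rightarrow> 'b) \<Rightarrow> bool" where
  "sigma_Cauchy R TR X TX s \<longleftrightarrow>
     (\<exists>U. zero_nbhd X TX U \<and>
       (\<forall>W B. zero_nbhd X TX W \<longrightarrow> module_bounded R TR X TX B \<longrightarrow>
         (\<exists>k0. \<forall>k\<ge>k0. \<forall>m\<ge>k0. bi_image (bi_diff X (s k) (s m)) U B \<subseteq> W)))"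

end

theory Submission
  imports Defs "HOL-Analysis.Elementary_Metric_Spaces"
begin

text \<open>
  The counterexample is the coordinatewise product on the space of all real sequences over the
  field of reals, where sequences carry the product topology. In this topology a neighborhood of
  zero restricts only finitely many coordinates, and a set is bounded iff each of its coordinates
  is bounded (\<open>bounded_iff_coordinatewise\<close>).

  A product that is computed only on a set \<open>A\<close> of coordinates, and is zero elsewhere, is
  \<open>n/2\<close>-bounded exactly if \<open>A\<close> is finite (\<open>half_n_bounded_iff_finite\<close>): a finite \<open>A\<close> can be
  controlled by one neighborhood, whereas for an infinite \<open>A\<close> every neighborhood leaves some
  coordinate in \<open>A\<close> free, and multiplying this coordinate by one produces an unbounded set.
  On the other hand, two such products that agree on the first \<open>n\<close> coordinates differ
  by a map whose values vanish there, and these values lie in any prescribed neighborhood of zero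
  once \<open>n\<close> is large (\<open>difference_in_nbhd\<close>). Hence the truncations to the first \<open>k\<close> coordinates are
  \<open>n/2\<close>-bounded and converge, uniformly on the whole space, to the full product, which is not
  \<open>n/2\<close>-bounded.
\<close>

section \<open>The module of real sequences\<close>

definition real_ring :: "real ring" where
  "real_ring = \<lparr>carrier = UNIV, mult = (*), one = 1, zero = 0, add = (+)\<rparr>"

definition seq_module :: "(real, nat \<Rightarrow> real) module" where
  "seq_module = \<lparr>carrier = UNIV, mult = (\<lambda>x y i. x i * y i), one = (\<lambda>_. 1),
     zero = (\<lambda>_. 0), add = (\<lambda>x y i. x i + y i), smult = (\<lambda>a x i. a * x i)\<rparr>"

lemma real_ring_simps [simp]:
  "carrier real_ring = UNIV" "mult real_ring = (*)" "one real_ring = 1"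
  "zero real_ring = 0" "add real_ring = (+)"
  by (simp_all add: real_ring_def)

lemma seq_module_simps [simp]:
  "carrier seq_module = UNIV" "zero seq_module = (\<lambda>_. 0)"
  "add seq_module = (\<lambda>x y i. x i + y i)" "smult seq_module = (\<lambda>a x i. a * x i)"
  by (simp_all add: seq_module_def)

lemma ring_real_ring: "ring real_ring"
proof (rule ringI)
  show "abelian_group real_ring"
  proof (rule abelian_groupI)
    fix x :: real
    show "\<exists>y\<in>carrier real_ring. y \<oplus>\<^bsub>real_ring\<^esub> x = \<zero>\<^bsub>real_ring\<^esub>"
      by (rule bexI[of _ "- x"]) auto
  qed auto
  show "Group.monoid real_ring"
    by (rule monoidI) auto
qed (auto simp: algebra_simps)

lemma abelian_group_seq_module: "abelian_group seq_module"
proof (rule abelian_groupI)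
  fix x :: "nat \<Rightarrow> real"
  show "\<exists>y\<in>carrier seq_module. y \<oplus>\<^bsub>seq_module\<^esub> x = \<zero>\<^bsub>seq_module\<^esub>"
    by (rule bexI[of _ "\<lambda>i. - x i"]) auto
qed (auto simp: algebra_simps)

lemma a_inv_real_ring [simp]: "\<ominus>\<^bsub>real_ring\<^esub> x = - x"
proof -
  interpret ring real_ring by (rule ring_real_ring)
  show ?thesis by (rule minus_equality) auto
qed

lemma a_inv_seq_module [simp]: "\<ominus>\<^bsub>seq_module\<^esub> x = (\<lambda>i. - x i)"
proof -
  interpret abelian_group seq_module by (rule abelian_group_seq_module)
  show ?thesis by (rule minus_equality) auto
qed

lemma topological_ring_real: "topological_ring real_ring euclidean"
proof -
  interpret ring real_ring by (rule ring_real_ring)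
  show ?thesis
    by unfold_locales
      (auto simp: case_prod_unfold intro!: continuous_intros)
qed

lemma topological_module_seq: "topological_module real_ring euclidean seq_module euclidean"
proof -
  interpret R: topological_ring real_ring euclidean by (rule topological_ring_real)
  interpret X: abelian_group seq_module by (rule abelian_group_seq_module)
  note coord = continuous_on_product_then_coordinatewise
  show ?thesis
  proof unfold_locales
    show "continuous_map (prod_topology euclidean euclidean) euclidean
        (\<lambda>(x, y). x \<oplus>\<^bsub>seq_module\<^esub> y)"
      by (auto simp: case_prod_unfold intro!: continuous_on_coordinatewise_then_product
          continuous_on_add coord[OF continuous_on_fst] coord[OF continuous_on_snd] continuous_on_id)
    show "continuous_map euclidean euclidean (\<lambda>x. \<ominus>\<^bsub>seq_module\<^esub> x)"
      by (auto intro!: continuous_on_coordinatewise_then_product continuous_on_minus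
          coord[OF continuous_on_id])
    show "continuous_map (prod_topology euclidean euclidean) euclidean
        (\<lambda>(a, x). a \<odot>\<^bsub>seq_module\<^esub> x)"
      by (auto simp: case_prod_unfold intro!: continuous_on_coordinatewise_then_product
          continuous_on_mult continuous_on_fst coord[OF continuous_on_snd] continuous_on_id)
  qed (auto simp: algebra_simps)
qed

section \<open>Neighborhoods and bounded sets\<close>

definition box :: "nat \<Rightarrow> real \<Rightarrow> (nat \<Rightarrow> real) set" where
  "box n e = {x. \<forall>i<n. \<bar>x i\<bar> < e}"

lemma zero_nbhd_box:
  assumes "e > 0"
  shows "zero_nbhd seq_module euclidean (box n e)"
proof -
  have "box n e = {x. \<forall>i\<in>{..<n}. x i \<in> {-e<..<e}}"
    by (force simp: box_def abs_less_iff)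
  moreover have "open \<dots>"
    by (rule product_topology_basis') auto
  ultimately have "open (box n e)" by simp
  then show ?thesis
    using assms by (simp add: zero_nbhd_def interior_open) (simp add: box_def)
qed

lemma zero_nbhd_contains_box:
  assumes "zero_nbhd seq_module euclidean W"
  obtains n e where "e > 0" "box n e \<subseteq> W"
proof -
  have "openin (product_topology (\<lambda>i. euclidean) UNIV) (interior W)"
    by (simp add: euclidean_product_topology)
  moreover have "(\<lambda>_. 0) \<in> interior W"
    using assms by (simp add: zero_nbhd_def)
  ultimately obtain X where X: "(\<lambda>_. 0) \<in> (\<Pi>\<^sub>E i\<in>UNIV. X i)" "\<And>i. open (X i)"
    "finite {i. X i \<noteq> UNIV}" "(\<Pi>\<^sub>E i\<in>UNIV. X i) \<subseteq> interior W"
    using product_topology_open_contains_basis[of "\<lambda>i. euclidean" UNIV "interior W" "\<lambda>_. 0"]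
    by auto
  have "\<exists>e>0. ball 0 e \<subseteq> X i" for i
    using X(1,2) by (auto simp: PiE_iff open_contains_ball)
  then obtain r where r: "\<And>i. r i > 0" "\<And>i. ball 0 (r i) \<subseteq> X i"
    by metis
  obtain n where n: "{i. X i \<noteq> UNIV} \<subseteq> {..<n}"
    using X(3) finite_nat_iff_bounded by blast
  define e where "e = Min (insert 1 (r ` {..<n}))"
  have "e > 0"
    using r(1) by (simp add: e_def)
  moreover have "box n e \<subseteq> W"
  proof
    fix x assume x: "x \<in> box n e"
    have "x i \<in> X i" for i
    proof (cases "i < n")
      case True
      then have "e \<le> r i"
        by (auto simp: e_def intro!: Min_le)
      then show ?thesis
        using x True r(2)[of i] by (force simp: box_def)
    next
      case False
      then show ?thesis using n by auto
    qed
    then show "x \<in> W"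
      using X(4) interior_subset[of W] by (auto simp: PiE_iff subset_iff)
  qed
  ultimately show ?thesis by (rule that)
qed

text \<open>
  A neighborhood of zero constrains only finitely many coordinates, so a single scalar
  radius can serve all of the corresponding coordinate bounds.
\<close>

lemma bounded_iff_coordinatewise:
  "module_bounded real_ring euclidean seq_module euclidean B \<longleftrightarrow> (\<forall>i. \<exists>M. \<forall>b\<in>B. \<bar>b i\<bar> \<le> M)"
proof
  assume B: "module_bounded real_ring euclidean seq_module euclidean B"
  show "\<forall>i. \<exists>M. \<forall>b\<in>B. \<bar>b i\<bar> \<le> M"
  proof
    fix i
    obtain V where V: "zero_nbhd real_ring euclidean V"
      "{v \<odot>\<^bsub>seq_module\<^esub> b | v b. v \<in> V \<and> b \<in> B} \<subseteq> box (Suc i) 1"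
      using B zero_nbhd_box[of 1 "Suc i"] by (auto simp: module_bounded_def)
    obtain d where d: "d > 0" "cball 0 d \<subseteq> V"
      using V(1) by (auto simp: zero_nbhd_def mem_interior_cball)
    have "\<bar>b i\<bar> \<le> 1 / d" if "b \<in> B" for b
    proof -
      have "d \<in> V" using d by auto
      then have "(\<lambda>i. d * b i) \<in> box (Suc i) 1"
        using V(2) that by auto
      then have "\<bar>d * b i\<bar> < 1"
        by (simp add: box_def)
      then show ?thesis
        using d(1) by (simp add: abs_mult field_simps)
    qed
    then show "\<exists>M. \<forall>b\<in>B. \<bar>b i\<bar> \<le> M" by blast
  qed
next
  assume "\<forall>i. \<exists>M. \<forall>b\<in>B. \<bar>b i\<bar> \<le> M"
  then obtain M where M: "\<And>i b. b \<in> B \<Longrightarrow> \<bar>b i\<bar> \<le> M i"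
    by metis
  have "\<exists>V. zero_nbhd real_ring euclidean V \<and>
      {v \<odot>\<^bsub>seq_module\<^esub> b | v b. v \<in> V \<and> b \<in> B} \<subseteq> W"
    if W: "zero_nbhd seq_module euclidean W" for W
  proof -
    obtain n e where e: "e > 0" "box n e \<subseteq> W"
      using zero_nbhd_contains_box[OF W] .
    define K where "K = Max (insert 1 (M ` {..<n}))"
    have K: "K > 0" "\<And>i. i < n \<Longrightarrow> M i \<le> K"
      by (auto simp: K_def less_le_trans[OF zero_less_one] intro!: Max_ge)
    have "zero_nbhd real_ring euclidean (ball 0 (e / K))"
      using e(1) K(1) by (simp add: zero_nbhd_def interior_open)
    moreover have "(\<lambda>i. v * b i) \<in> W" if "v \<in> ball 0 (e / K)" "b \<in> B" for v b
    proof -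
      have "\<bar>v * b i\<bar> < e" if "i < n" for i
      proof -
        have "\<bar>v * b i\<bar> \<le> \<bar>v\<bar> * K"
          using M[OF \<open>b \<in> B\<close>, of i] K(2)[OF that] by (auto simp: abs_mult intro: mult_left_mono)
        also have "\<dots> < e"
          using \<open>v \<in> ball 0 (e / K)\<close> K(1) by (simp add: field_simps)
        finally show ?thesis .
      qed
      then show ?thesis
        using e(2) by (auto simp: box_def)
    qed
    ultimately show ?thesis
      by (intro exI[of _ "ball 0 (e / K)"]) auto
  qed
  then show "module_bounded real_ring euclidean seq_module euclidean B"
    by (simp add: module_bounded_def)
qed

section \<open>Coordinatewise products restricted to a set of coordinates\<close>

definition product_on :: "nat set \<Rightarrow> (nat \<Rightarrow> real) \<Rightarrow> (nat \<Rightarrow> real) \<Rightarrow> nat \<Rightarrow> real" where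
  "product_on A x y = (\<lambda>i. if i \<in> A then x i * y i else 0)"

lemma bigroup_hom_product_on: "bigroup_hom seq_module (product_on A)"
  by (auto simp: bigroup_hom_def hom_def product_on_def algebra_simps)

text \<open>
  For infinite \<open>A\<close> the unboundedness is already visible on the bounded set consisting of the
  constant sequence one: a neighborhood of zero contains all multiples of some unit
  vector whose index lies in \<open>A\<close>.
\<close>

lemma half_n_bounded_iff_finite:
  "half_n_bounded real_ring euclidean seq_module euclidean (product_on A) \<longleftrightarrow> finite A"
proof
  assume "finite A"
  then obtain n where n: "A \<subseteq> {..<n}"
    using finite_nat_iff_bounded by blast
  have "\<exists>M. \<forall>z\<in>bi_image (product_on A) (box n 1) B. \<bar>z i\<bar> \<le> M"
    if B: "\<forall>i. \<exists>M. \<forall>b\<in>B. \<bar>b i\<bar> \<le> M" for B i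
  proof -
    obtain M where M: "\<And>b. b \<in> B \<Longrightarrow> \<bar>b i\<bar> \<le> M"
      using B by metis
    have "\<bar>product_on A x b i\<bar> \<le> \<bar>M\<bar>" if "x \<in> box n 1" "b \<in> B" for x b
    proof (cases "i \<in> A")
      case True
      then have "\<bar>x i\<bar> \<le> 1"
        using n that(1) by (auto simp: box_def intro: less_imp_le)
      then have "\<bar>x i\<bar> * \<bar>b i\<bar> \<le> 1 * \<bar>M\<bar>"
        using M[OF that(2)] by (intro mult_mono) auto
      then show ?thesis
        using True by (simp add: product_on_def abs_mult)
    qed (simp add: product_on_def)
    then show ?thesis
      by (auto simp: bi_image_def)
  qed
  then show "half_n_bounded real_ring euclidean seq_module euclidean (product_on A)"
    unfolding half_n_bounded_def bounded_iff_coordinatewise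
    by (intro exI[of _ "box n 1"]) (auto simp: zero_nbhd_box)
next
  assume "half_n_bounded real_ring euclidean seq_module euclidean (product_on A)"
  then obtain U where U: "zero_nbhd seq_module euclidean U"
    "\<And>B. \<forall>i. \<exists>M. \<forall>b\<in>B. \<bar>b i\<bar> \<le> M \<Longrightarrow>
      \<forall>i. \<exists>M. \<forall>z\<in>bi_image (product_on A) U B. \<bar>z i\<bar> \<le> M"
    unfolding half_n_bounded_def bounded_iff_coordinatewise by blast
  obtain n e where e: "e > 0" "box n e \<subseteq> U"
    using zero_nbhd_contains_box[OF U(1)] .
  show "finite A"
  proof (rule ccontr)
    assume "infinite A"
    then obtain j where j: "j \<in> A" "j \<ge> n"
      by (meson infinite_nat_iff_unbounded_le)
    obtain M where M: "\<And>z. z \<in> bi_image (product_on A) U {\<lambda>_. 1} \<Longrightarrow> \<bar>z j\<bar> \<le> M"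
      using U(2)[of "{\<lambda>_. 1}"] by (metis order_refl singletonD)
    define x :: "nat \<Rightarrow> real" where "x = (\<lambda>i. if i = j then \<bar>M\<bar> + 1 else 0)"
    have "x \<in> U"
      using e j by (auto simp: box_def x_def)
    then have "\<bar>product_on A x (\<lambda>_. 1) j\<bar> \<le> M"
      by (intro M) (auto simp: bi_image_def)
    then show False
      using j by (simp add: product_on_def x_def)
  qed
qed

text \<open>
  Where the two products agree, the difference is exactly zero, and the coordinates from
  \<open>n\<close> on are unconstrained by the neighborhood. So \<open>n\<close> depends on \<open>W\<close> alone, and the arguments may
  range over arbitrary sets \<open>U\<close> and \<open>B\<close>.
\<close>

lemma difference_in_nbhd:
  assumes "zero_nbhd seq_module euclidean W"
  obtains n where "\<And>A C U B. A \<inter> {..<n} = C \<inter> {..<n} \<Longrightarrow>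
    bi_image (bi_diff seq_module (product_on A) (product_on C)) U B \<subseteq> W"
proof -
  obtain n e where e: "e > 0" "box n e \<subseteq> W"
    using zero_nbhd_contains_box[OF assms] .
  have "bi_image (bi_diff seq_module (product_on A) (product_on C)) U B \<subseteq> W"
    if "A \<inter> {..<n} = C \<inter> {..<n}" for A C U B
  proof -
    have "i \<in> A \<longleftrightarrow> i \<in> C" if "i < n" for i
      using \<open>A \<inter> {..<n} = C \<inter> {..<n}\<close> that by blast
    then have "bi_diff seq_module (product_on A) (product_on C) x y \<in> box n e" for x y
      using e(1) by (simp add: bi_diff_def a_minus_def box_def product_on_def)
    then show ?thesis
      using e(2) by (auto simp: bi_image_def)
  qed
  then show ?thesis by (rule that)
qed

section \<open>The Cauchy sequence of truncations\<close>

theorem mainTheorem6: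
  shows "\<exists>(R :: real ring) (TR :: real topology)
           (X :: (real, nat \<Rightarrow> real) module) (TX :: (nat \<Rightarrow> real) topology)
           (s :: nat \<Rightarrow> (nat \<Rightarrow> real) \<Rightarrow> (nat \<Rightarrow> real) \<Rightarrow> (nat \<Rightarrow> real))
           (\<sigma> :: (nat \<Rightarrow> real) \<Rightarrow> (nat \<Rightarrow> real) \<Rightarrow> (nat \<Rightarrow> real)).
           topological_ring R TR \<and>
           topological_module R TR X TX \<and>
           (\<forall>k. s k \<in> B_half_n R TR X TX) \<and>
           sigma_Cauchy R TR X TX s \<and>
           bigroup_hom X \<sigma> \<and>
           sigma_converges R TR X TX s \<sigma> \<and>
           \<not> half_n_bounded R TR X TX \<sigma>"
proof (intro exI conjI allI)
  have whole: "zero_nbhd seq_module euclidean UNIV"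
    by (simp add: zero_nbhd_def)
  show "topological_ring real_ring euclidean"
    by (rule topological_ring_real)
  show "topological_module real_ring euclidean seq_module euclidean"
    by (rule topological_module_seq)
  show "product_on {..<k} \<in> B_half_n real_ring euclidean seq_module euclidean" for k
    by (simp add: B_half_n_def bigroup_hom_product_on half_n_bounded_iff_finite)
  show "sigma_Cauchy real_ring euclidean seq_module euclidean (\<lambda>k. product_on {..<k})"
    unfolding sigma_Cauchy_def
  proof (intro exI[of _ UNIV] conjI allI impI whole)
    fix W :: "(nat \<Rightarrow> real) set" and B
    assume "zero_nbhd seq_module euclidean W"
    then obtain n where n: "\<And>A C U B. A \<inter> {..<n} = C \<inter> {..<n} \<Longrightarrow>
        bi_image (bi_diff seq_module (product_on A) (product_on C)) U B \<subseteq> W"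
      using difference_in_nbhd by blast
    show "\<exists>k0. \<forall>k\<ge>k0. \<forall>m\<ge>k0.
        bi_image (bi_diff seq_module (product_on {..<k}) (product_on {..<m})) UNIV B \<subseteq> W"
      by (intro exI[of _ n] allI impI n) auto
  qed
  show "bigroup_hom seq_module (product_on UNIV)"
    by (rule bigroup_hom_product_on)
  show "sigma_converges real_ring euclidean seq_module euclidean
      (\<lambda>k. product_on {..<k}) (product_on UNIV)"
    unfolding sigma_converges_def
  proof (intro exI[of _ UNIV] conjI allI impI whole)
    fix W :: "(nat \<Rightarrow> real) set" and B
    assume "zero_nbhd seq_module euclidean W"
    then obtain n where n: "\<And>A C U B. A \<inter> {..<n} = C \<inter> {..<n} \<Longrightarrow>
        bi_image (bi_diff seq_module (product_on A) (product_on C)) U B \<subseteq> W"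
      using difference_in_nbhd by blast
    show "\<exists>k0. \<forall>k\<ge>k0.
        bi_image (bi_diff seq_module (product_on {..<k}) (product_on UNIV)) UNIV B \<subseteq> W"
      by (intro exI[of _ n] allI impI n) auto
  qed
  show "\<not> half_n_bounded real_ring euclidean seq_module euclidean (product_on UNIV)"
    by (simp add: half_n_bounded_iff_finite)
qed

end
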